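(* In the two-item setting of the context, for a user of type $\theta\in\Theta_1$, in any equilibrium under algorithmic entry where $m_\theta^{\mathrm{AE}}>\lambda_\theta/\alpha_\theta(b)$ and $\gamma_{\mathcal H}\neq r_\theta(a)/r_\theta(b)$, the user's strategy is $$f_\theta^{\mathrm{AE}}(b)=1,\qquad f_\theta^{\mathrm{AE}}(a)=\mathbf 1\Big\{\gamma_{\mathcal H}<\frac{r_\theta(a)}{r_\theta(b)}\Big\}.$$
   Context: Setting. $\Theta$ is a finite set of user types, partitioned as $\Theta=\Theta_1\sqcup\Theta_2$, and $S=\{a,b\}$ is the set of items. For each $\theta\in\Theta$, $s\in S$ there are $\alpha_\theta(s)>0$ and an expected reward $r_\theta(s)\in\mathbb R$. For all $\theta$: $1/\alpha_\theta(a)>1/\alpha_\theta(b)$. For $\theta\in\Theta_1$: $r_\theta(a)<r_\theta(b)$ (so $s^*_\theta=b$). For $\theta\in\Theta_2$: $r_\theta(a)>r_\theta(b)$ (so $s^*_\theta=a$). The algorithm's discount factor is $\gamma_{\mathcal A}\in[0,1)$ and the users' discount factor is $\gamma_{\mathcal H}\in[0,1)$. $\boldsymbol\lambda=(\lambda_\theta)$ is a commonly known prior on $\Theta$. Interaction. A session involves one user of a fixed type $\theta$. At each step the algorithm recommends an item $s$; the user engages with probability $f_\theta(s)\in[0,1]$ (independently across steps). If she engages, the engagement length $y>0$ has mean $1/\alpha_\theta(s)$ and the user receives expected reward $r_\theta(s)$; otherwise $y=0$ and she receives nothing. The algorithm acts on only $\hat y=\mathbf 1\{y>0\}$, and knows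 the profile $\mathbf f=(f_\theta)_{\theta\in\Theta}$. $[\boldsymbol\lambda\mid(s,\hat y);\mathbf f]$ is the Bayes posterior, proportional to $\lambda_\theta f_\theta(s)$ if $\hat y=1$ and to $\lambda_\theta(1-f_\theta(s))$ if $\hat y=0$. Algorithm. $Q_{\mathcal A}(\boldsymbol\lambda,s;\mathbf f)$ is the maximum over recommendation policies of $\mathbb E[\sum_{t\ge1}\gamma_{\mathcal A}^{t-1}y_t]$ when $\theta\sim\boldsymbol\lambda$ and the first item is $s$. At each step the algorithm recommends an item maximizing $Q_{\mathcal A}$ at its current posterior; when taking the argmax one may assume that any item maximizing $Q_{\mathcal A}$ is chosen. Users. With the algorithm best responding to $\mathbf f$, type $\theta$'s value starting from posterior $\boldsymbol\lambda$ and item $s$ is $$Q_\theta(\boldsymbol\lambda,s;\mathbf f)=f_\theta(s)r_\theta(s)+\gamma_{\mathcal H}\mathbb E_{\hat y\sim\mathrm{Ber}(f_\theta(s))}Q_\theta\big([\boldsymbol\lambda\mid(s,\hat y);\mathbf f],\ \arg\max_{s'}Q_{\mathcal A}([\boldsymbol\lambda\mid(s,\hat y);\mathbf f],s';\mathbf f);\ \mathbf f\big).$$ Standing restrictions on strategies. For every $\theta$, $f_\theta(s^*_\theta)=1$, and for every $s$, $f_\theta(s)\in[0,\alpha_\theta(s)/\alpha_\theta(s^*_\theta))\cup\{1\}$ (and $f_\theta(s)\in[0,1]$). Equilibrium under algorithmic entry (AE). The algorithm chooses the first item, $s_1\in\arg\max_sQ_{\mathcal A}(\boldsymbol\lambda,s;\mathbf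 f)$. A profile $\mathbf f^{\mathrm{AE}}$ is an equilibrium if for every $\theta$, $f_\theta^{\mathrm{AE}}$ maximizes, over $f_\theta$, the quantity $Q_\theta(\boldsymbol\lambda,\arg\max_sQ_{\mathcal A}(\boldsymbol\lambda,s;\mathbf g);\mathbf g)$ with $\mathbf g=(f_\theta,\mathbf f^{\mathrm{AE}}_{-\theta})$ (the algorithm best responds to the deviated profile). Margin. For a profile $\mathbf f$ let $$h_\theta=\frac{1-\gamma_{\mathcal A}}{(1-\gamma_{\mathcal A}f_\theta(a))(1-\gamma_{\mathcal A}f_\theta(b))}\Big[\frac{f_\theta(a)}{\alpha_\theta(a)}-\frac{f_\theta(b)}{\alpha_\theta(b)}\Big].$$ The margin from the perspective of $\theta$ is $m_\theta=\sum_{\theta'\in\Theta\setminus\{\theta\}}h_{\theta'}\lambda_{\theta'}$, and $m_\theta^{\mathrm{AE}}$ is its value when the other types play $\mathbf f^{\mathrm{AE}}_{-\theta}$.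
   Formalization: The formal theorem additionally assumes r_θ(b) > 0 (for r_θ(b) < 0 the stated formula is false, for r_θ(b) = 0 the ratio is undefined) and λ_θ > 0 for the user's own type (otherwise the posteriors along her play may be undefined). *)

theory Defs
  imports "HOL-Probability.Probability"
begin

text \<open>
  User types are the elements of a finite type \<open>'t\<close>; \<open>\<alpha> \<theta> s\<close> is the reciprocal of the mean
  engagement length and \<open>r \<theta> s\<close> the expected reward of type \<open>\<theta>\<close> on item \<open>s\<close>.
\<close>

datatype item = Item_a | Item_b

instance item :: finite
proof
  have "(UNIV :: item set) \<subseteq> {Item_a, Item_b}"
    using item.exhaust by blast
  then show "finite (UNIV :: item set)"
    using finite_subset by blast
qed

type_synonym 't profile = "'t \<Rightarrow> item \<Rightarrow> real"
type_synonym 't belief = "'t \<Rightarrow> real"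
type_synonym history = "(item \<times> bool) list"
type_synonym policy = "history \<Rightarrow> item pmf"

text \<open>
  The Bayes posterior. For an observation of probability zero, division by zero makes it the
  zero function; no type in the support of \<open>q\<close> ever produces such an observation.
\<close>

definition posterior :: "'t::finite profile \<Rightarrow> 't belief \<Rightarrow> item \<Rightarrow> bool \<Rightarrow> 't belief" where
  "posterior f q s y = (\<lambda>\<theta>. q \<theta> * (if y then f \<theta> s else 1 - f \<theta> s) /
     (\<Sum>\<theta>'\<in>UNIV. q \<theta>' * (if y then f \<theta>' s else 1 - f \<theta>' s)))"

text \<open>
  Law of the first \<open>n\<close> pairs (item, engaged or not), oldest first, in a session with a user of
  type \<open>\<theta>\<close>. Policies may be randomised and see only items and engagement indicators.
\<close>

primrec history_pmf :: "'t profile \<Rightarrow> 't \<Rightarrow> policy \<Rightarrow> nat \<Rightarrow> history pmf" where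
  "history_pmf f \<theta> \<pi> 0 = return_pmf []"
| "history_pmf f \<theta> \<pi> (Suc n) =
     bind_pmf (history_pmf f \<theta> \<pi> n) (\<lambda>h.
       bind_pmf (\<pi> h) (\<lambda>s.
         map_pmf (\<lambda>y. h @ [(s, y)]) (bernoulli_pmf (f \<theta> s))))"

text \<open>
  Mean engagement length of step \<open>n + 1\<close>, with the length replaced by its conditional mean
  given the item and whether the user engaged.
\<close>

definition mean_length :: "('t \<Rightarrow> item \<Rightarrow> real) \<Rightarrow> 't profile \<Rightarrow> 't \<Rightarrow> policy \<Rightarrow> nat \<Rightarrow> real" where
  "mean_length \<alpha> f \<theta> \<pi> n =
     measure_pmf.expectation (history_pmf f \<theta> \<pi> (Suc n))
       (\<lambda>h. case last h of (s, y) \<Rightarrow> if y then 1 / \<alpha> \<theta> s else 0)"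

definition policy_value ::
  "('t::finite \<Rightarrow> item \<Rightarrow> real) \<Rightarrow> real \<Rightarrow> 't profile \<Rightarrow> 't belief \<Rightarrow> policy \<Rightarrow> real" where
  "policy_value \<alpha> \<gamma>A f q \<pi> = (\<Sum>\<theta>\<in>UNIV. q \<theta> * (\<Sum>n. \<gamma>A ^ n * mean_length \<alpha> f \<theta> \<pi> n))"

definition Q_alg ::
  "('t::finite \<Rightarrow> item \<Rightarrow> real) \<Rightarrow> real \<Rightarrow> 't profile \<Rightarrow> 't belief \<Rightarrow> item \<Rightarrow> real" where
  "Q_alg \<alpha> \<gamma>A f q s = (SUP \<pi>\<in>{\<pi>. \<pi> [] = return_pmf s}. policy_value \<alpha> \<gamma>A f q \<pi>)"

text \<open>
  A best-responding algorithm: \<open>\<sigma> f q\<close> is the item recommended at posterior \<open>q\<close> when the profile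
  is \<open>f\<close>. Ties are broken arbitrarily, possibly differently at different profiles and posteriors.
\<close>

definition best_responding ::
  "('t::finite \<Rightarrow> item \<Rightarrow> real) \<Rightarrow> real \<Rightarrow> ('t profile \<Rightarrow> 't belief \<Rightarrow> item) \<Rightarrow> bool" where
  "best_responding \<alpha> \<gamma>A \<sigma> \<longleftrightarrow> (\<forall>f q. is_arg_max (Q_alg \<alpha> \<gamma>A f q) (\<lambda>_. True) (\<sigma> f q))"

definition user_bellman ::
  "('t::finite \<Rightarrow> item \<Rightarrow> real) \<Rightarrow> real \<Rightarrow> ('t profile \<Rightarrow> 't belief \<Rightarrow> item) \<Rightarrow> 't profile \<Rightarrow> 't
    \<Rightarrow> ('t belief \<Rightarrow> item \<Rightarrow> real) \<Rightarrow> bool" where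
  "user_bellman r \<gamma>H \<sigma> f \<theta> Q \<longleftrightarrow>
     (\<forall>q s. Q q s = f \<theta> s * r \<theta> s +
        \<gamma>H * measure_pmf.expectation (bernoulli_pmf (f \<theta> s))
               (\<lambda>y. Q (posterior f q s y) (\<sigma> f (posterior f q s y))))"

text \<open>
  The recursion may have further, unbounded solutions; the value function is the bounded one,
  which exists and is unique by \<open>user_value_ex1\<close> below.
\<close>

definition Q_user ::
  "('t::finite \<Rightarrow> item \<Rightarrow> real) \<Rightarrow> real \<Rightarrow> ('t profile \<Rightarrow> 't belief \<Rightarrow> item) \<Rightarrow> 't profile \<Rightarrow> 't
    \<Rightarrow> 't belief \<Rightarrow> item \<Rightarrow> real" where
  "Q_user r \<gamma>H \<sigma> f \<theta> =
     (THE Q. (\<exists>B. \<forall>q s. \<bar>Q q s\<bar> \<le> B) \<and> user_bellman r \<gamma>H \<sigma> f \<theta> Q)"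

lemma bernoulli_expectation_abs_le:
  fixes u :: "bool \<Rightarrow> real"
  assumes "\<And>y. \<bar>u y\<bar> \<le> B"
  shows "\<bar>measure_pmf.expectation (bernoulli_pmf p) u\<bar> \<le> B"
proof -
  have i: "integrable (measure_pmf (bernoulli_pmf p)) v" for v :: "bool \<Rightarrow> real"
    by (rule integrable_measure_pmf_finite) simp
  have "\<bar>measure_pmf.expectation (bernoulli_pmf p) u\<bar>
      \<le> measure_pmf.expectation (bernoulli_pmf p) (\<lambda>y. \<bar>u y\<bar>)"
    by (rule integral_abs_bound)
  also have "\<dots> \<le> B"
    by (rule measure_pmf.integral_le_const[OF i]) (simp add: assms)
  finally show ?thesis .
qed

lemma user_value_ex1:
  assumes "0 \<le> \<gamma>H" "\<gamma>H < 1"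
  shows "\<exists>!Q. (\<exists>B. \<forall>q s. \<bar>Q q s\<bar> \<le> B) \<and> user_bellman r \<gamma>H \<sigma> f \<theta> Q"
proof -
  define E where "E = (\<lambda>s (u::bool \<Rightarrow> real). measure_pmf.expectation (bernoulli_pmf (f \<theta> s)) u)"
  define T where "T = (\<lambda>(Q::'a belief \<Rightarrow> item \<Rightarrow> real) q s.
     E s (\<lambda>y. Q (posterior f q s y) (\<sigma> f (posterior f q s y))))"
  have i: "integrable (measure_pmf (bernoulli_pmf p)) v" for v :: "bool \<Rightarrow> real" and p
    by (rule integrable_measure_pmf_finite) simp
  have T_bound: "\<bar>T Q q s\<bar> \<le> B" if "\<And>q s. \<bar>Q q s\<bar> \<le> B" for Q B q s
    unfolding T_def E_def by (rule bernoulli_expectation_abs_le) (rule that)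
  have T_diff: "T P q s - T Q q s = T (\<lambda>q s. P q s - Q q s) q s" for P Q q s
    unfolding T_def E_def by (rule Bochner_Integration.integral_diff[symmetric]; rule i)
  have ub: "user_bellman r \<gamma>H \<sigma> f \<theta> Q \<longleftrightarrow> (\<forall>q s. Q q s = f \<theta> s * r \<theta> s + \<gamma>H * T Q q s)" for Q
    unfolding user_bellman_def T_def E_def ..
  define C where "C = Max (range (\<lambda>s. \<bar>f \<theta> s * r \<theta> s\<bar>))"
  define D where "D = rec_nat (\<lambda>(q::'a belief) s. f \<theta> s * r \<theta> s) (\<lambda>_. T)"
  have D0: "D 0 q s = f \<theta> s * r \<theta> s" and DS: "D (Suc n) = T (D n)" for n q s
    by (simp_all add: D_def)
  have D_bound: "\<bar>D n q s\<bar> \<le> C" for n q s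
  proof (induction n arbitrary: q s)
    case 0
    show ?case by (simp add: D0 C_def)
  next
    case (Suc n)
    then show ?case unfolding DS by (rule T_bound)
  qed
  have geo: "summable (\<lambda>n. C * \<gamma>H ^ n)"
    using assms by (intro summable_mult summable_geometric) auto
  have le: "norm (\<gamma>H ^ n * D n q s) \<le> C * \<gamma>H ^ n" for n q s
    using mult_right_mono[OF D_bound[of n q s], of "\<gamma>H ^ n"] assms
    by (simp add: abs_mult mult.commute)
  have summ: "summable (\<lambda>n. \<gamma>H ^ n * D n q s)" for q s
    by (rule summable_comparison_test'[OF geo]) (rule le)
  define V where "V = (\<lambda>q s. \<Sum>n. \<gamma>H ^ n * D n q s)"
  have V_bound: "\<bar>V q s\<bar> \<le> (\<Sum>n. C * \<gamma>H ^ n)" for q s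
  proof -
    have "norm (V q s) \<le> (\<Sum>n. C * \<gamma>H ^ n)"
      unfolding V_def by (rule norm_suminf_le[OF le geo])
    then show ?thesis by simp
  qed
  have E2: "E s u = p * u True + (1 - p) * u False" if "p = min 1 (max 0 (f \<theta> s))" for s u p
  proof -
    have "E s u = (\<Sum>y\<in>UNIV. u y * pmf (bernoulli_pmf (f \<theta> s)) y)"
      unfolding E_def by (rule integral_measure_pmf_real) auto
    then show ?thesis
      using that by (simp add: UNIV_bool bernoulli_pmf.rep_eq algebra_simps)
  qed
  have T_sum: "(\<lambda>n. \<gamma>H ^ n * T (D n) q s) sums T V q s" for q s
  proof -
    have *: "(\<lambda>n. \<gamma>H ^ n * D n q' s') sums V q' s'" for q' s'
      unfolding V_def by (rule summable_sums[OF summ])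
    define p where "p = min 1 (max 0 (f \<theta> s))"
    define q1 where "q1 = posterior f q s True"
    define q0 where "q0 = posterior f q s False"
    have T2: "T Q q s = p * Q q1 (\<sigma> f q1) + (1 - p) * Q q0 (\<sigma> f q0)" for Q
      unfolding T_def E2[OF p_def] q1_def q0_def ..
    show ?thesis
      unfolding T2
      using sums_add[OF sums_mult[OF *[of q1 "\<sigma> f q1"], of p]
          sums_mult[OF *[of q0 "\<sigma> f q0"], of "1 - p"]]
      by (simp add: algebra_simps)
  qed
  have V_fix: "V q s = f \<theta> s * r \<theta> s + \<gamma>H * T V q s" for q s
  proof -
    have "V q s = \<gamma>H ^ 0 * D 0 q s + (\<Sum>n. \<gamma>H ^ Suc n * D (Suc n) q s)"
      unfolding V_def by (subst suminf_split_head[OF summ]) simp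
    also have "(\<Sum>n. \<gamma>H ^ Suc n * D (Suc n) q s) = \<gamma>H * T V q s"
      using sums_unique[OF sums_mult[OF T_sum[of q s], of \<gamma>H]] by (simp add: DS mult.assoc)
    finally show ?thesis by (simp add: D0)
  qed
  have uniq: "P = Q"
    if P: "\<And>q s. \<bar>P q s\<bar> \<le> B" "user_bellman r \<gamma>H \<sigma> f \<theta> P"
      and Q: "\<And>q s. \<bar>Q q s\<bar> \<le> B'" "user_bellman r \<gamma>H \<sigma> f \<theta> Q" for P Q B B'
  proof -
    define d where "d = (\<lambda>q s. P q s - Q q s)"
    have d: "d q s = \<gamma>H * T d q s" for q s
      using P(2) Q(2) T_diff[of P q s Q] unfolding ub d_def
      by (metis (no_types, lifting) add_diff_cancel_left right_diff_distrib)
    have "\<bar>d q s\<bar> \<le> \<gamma>H ^ n * (B + B')" for n q s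
    proof (induction n arbitrary: q s)
      case 0
      show ?case using P(1)[of q s] Q(1)[of q s] by (simp add: d_def)
    next
      case (Suc n)
      have "\<bar>d q s\<bar> = \<gamma>H * \<bar>T d q s\<bar>"
        using d[of q s] assms(1) by (metis abs_mult abs_of_nonneg)
      also have "\<dots> \<le> \<gamma>H * (\<gamma>H ^ n * (B + B'))"
        by (intro mult_left_mono T_bound Suc assms(1))
      finally show ?case by simp
    qed
    moreover have "(\<lambda>n. \<gamma>H ^ n * (B + B')) \<longlonglongrightarrow> 0"
      using assms by (intro tendsto_mult_left_zero LIMSEQ_power_zero) simp
    ultimately have "\<bar>d q s\<bar> \<le> 0" for q s
      by (meson LIMSEQ_le_const)
    then show "P = Q" by (auto simp: d_def fun_eq_iff)
  qed
  show ?thesis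
  proof (rule ex1I[of _ V])
    show "(\<exists>B. \<forall>q s. \<bar>V q s\<bar> \<le> B) \<and> user_bellman r \<gamma>H \<sigma> f \<theta> V"
      using V_bound V_fix unfolding ub by blast
  next
    fix Q assume "(\<exists>B. \<forall>q s. \<bar>Q q s\<bar> \<le> B) \<and> user_bellman r \<gamma>H \<sigma> f \<theta> Q"
    moreover have "user_bellman r \<gamma>H \<sigma> f \<theta> V" using V_fix unfolding ub by blast
    ultimately show "Q = V" using uniq[of Q _ V] V_bound by blast
  qed
qed

definition favourite :: "('t \<Rightarrow> item \<Rightarrow> real) \<Rightarrow> 't \<Rightarrow> item" where
  "favourite r \<theta> = arg_max (r \<theta>) (\<lambda>_. True)"

definition admissible ::
  "('t \<Rightarrow> item \<Rightarrow> real) \<Rightarrow> ('t \<Rightarrow> item \<Rightarrow> real) \<Rightarrow> 't \<Rightarrow> (item \<Rightarrow> real) \<Rightarrow> bool" where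
  "admissible \<alpha> r \<theta> x \<longleftrightarrow>
     x (favourite r \<theta>) = 1 \<and>
     (\<forall>s. x s \<in> {0..1} \<and> x s \<in> {0..<\<alpha> \<theta> s / \<alpha> \<theta> (favourite r \<theta>)} \<union> {1})"

definition AE_payoff ::
  "('t::finite \<Rightarrow> item \<Rightarrow> real) \<Rightarrow> real \<Rightarrow> ('t profile \<Rightarrow> 't belief \<Rightarrow> item) \<Rightarrow> 't belief
    \<Rightarrow> 't profile \<Rightarrow> 't \<Rightarrow> real" where
  "AE_payoff r \<gamma>H \<sigma> prior f \<theta> = Q_user r \<gamma>H \<sigma> f \<theta> prior (\<sigma> f prior)"

definition AE_equilibrium ::
  "('t::finite \<Rightarrow> item \<Rightarrow> real) \<Rightarrow> ('t \<Rightarrow> item \<Rightarrow> real) \<Rightarrow> real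
    \<Rightarrow> ('t profile \<Rightarrow> 't belief \<Rightarrow> item) \<Rightarrow> 't belief \<Rightarrow> 't profile \<Rightarrow> bool" where
  "AE_equilibrium \<alpha> r \<gamma>H \<sigma> prior f \<longleftrightarrow>
     (\<forall>\<theta>. is_arg_max (\<lambda>x. AE_payoff r \<gamma>H \<sigma> prior (f(\<theta> := x)) \<theta>) (admissible \<alpha> r \<theta>) (f \<theta>))"

definition margin_weight :: "('t \<Rightarrow> item \<Rightarrow> real) \<Rightarrow> real \<Rightarrow> 't profile \<Rightarrow> 't \<Rightarrow> real" where
  "margin_weight \<alpha> \<gamma>A f \<theta> =
     (1 - \<gamma>A) / ((1 - \<gamma>A * f \<theta> Item_a) * (1 - \<gamma>A * f \<theta> Item_b)) *
       (f \<theta> Item_a / \<alpha> \<theta> Item_a - f \<theta> Item_b / \<alpha> \<theta> Item_b)"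

definition margin ::
  "('t::finite \<Rightarrow> item \<Rightarrow> real) \<Rightarrow> real \<Rightarrow> 't belief \<Rightarrow> 't profile \<Rightarrow> 't \<Rightarrow> real" where
  "margin \<alpha> \<gamma>A prior f \<theta> = (\<Sum>\<theta>'\<in>UNIV - {\<theta>}. margin_weight \<alpha> \<gamma>A f \<theta>' * prior \<theta>')"

end

theory Submission
  imports Defs
begin

text \<open>
  Every type surely engages with the item on which her expected length per step is larger. A
  non-engagement with one item therefore reveals that the other one is optimal for ever, and the
  only sensible policies are ``recommend \<open>s\<close> until the first non-engagement, then the other item''.
  The maximum of the two values so obtained satisfies the Bellman inequality, so it bounds every
  policy. The margin weight of a type is exactly the difference of her two values: a
  positive weighted sum of margin weights makes the algorithm recommend \<open>a\<close>. It stays positive after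
  engagements with \<open>a\<close>, since a type with negative weight is the only kind that may fail to engage.

  The margin hypothesis makes the sum positive whatever \<open>\<theta>\<close> plays. With \<open>x\<close> her engagement
  probability on \<open>a\<close>, her payoff is a fractional linear function of \<open>x\<close> whose monotonicity on \<open>[0,1]\<close> is
  decided by the sign of \<open>r\<^sub>\<theta>(a) - \<gamma>\<^sub>H r\<^sub>\<theta>(b)\<close>.
\<close>

fun other :: "item \<Rightarrow> item" where
  "other Item_a = Item_b"
| "other Item_b = Item_a"

lemma other_other [simp]: "other (other s) = s"
  by (cases s) auto

lemma other_neq: "s \<noteq> t \<Longrightarrow> t = other s"
  by (cases s; cases t) auto

definition continuation :: "policy \<Rightarrow> item \<times> bool \<Rightarrow> policy" where
  "continuation \<pi> x = (\<lambda>h. \<pi> (x # h))"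

lemma history_pmf_first_step:
  "history_pmf f \<theta> \<pi> (Suc n) =
     bind_pmf (\<pi> []) (\<lambda>s. bind_pmf (bernoulli_pmf (f \<theta> s)) (\<lambda>y.
       map_pmf (Cons (s, y)) (history_pmf f \<theta> (continuation \<pi> (s, y)) n)))"
proof (induction n)
  case 0
  show ?case
    by (simp add: bind_return_pmf map_pmf_def bind_assoc_pmf)
next
  case (Suc n)
  have "history_pmf f \<theta> \<pi> (Suc (Suc n)) =
      bind_pmf (history_pmf f \<theta> \<pi> (Suc n)) (\<lambda>h. bind_pmf (\<pi> h) (\<lambda>s.
         map_pmf (\<lambda>y. h @ [(s, y)]) (bernoulli_pmf (f \<theta> s))))"
    by simp
  also have "\<dots> = bind_pmf (\<pi> []) (\<lambda>s. bind_pmf (bernoulli_pmf (f \<theta> s)) (\<lambda>y.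
      map_pmf (Cons (s, y)) (history_pmf f \<theta> (continuation \<pi> (s, y)) (Suc n))))"
    unfolding Suc.IH
    by (simp add: map_pmf_def bind_assoc_pmf bind_return_pmf continuation_def)
  finally show ?case .
qed

lemma set_history_pmf: "h \<in> set_pmf (history_pmf f \<theta> \<pi> n) \<Longrightarrow> length h = n"
  by (induction n arbitrary: h) auto

lemma finite_set_history_pmf: "finite (set_pmf (history_pmf f \<theta> \<pi> n))"
  by (induction n) auto

lemma expectation_bind_item:
  fixes p :: "item pmf" and u :: "'b \<Rightarrow> real"
  assumes "\<And>s. finite (set_pmf (k s))"
  shows "measure_pmf.expectation (bind_pmf p k) u =
    (\<Sum>s\<in>UNIV. pmf p s * measure_pmf.expectation (k s) u)"
  using pmf_expectation_bind[of UNIV k p u] assms by simp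

lemma expectation_bind_bernoulli:
  fixes u :: "'b \<Rightarrow> real"
  assumes "\<And>y. finite (set_pmf (k y))" "0 \<le> x" "x \<le> 1"
  shows "measure_pmf.expectation (bind_pmf (bernoulli_pmf x) k) u =
    x * measure_pmf.expectation (k True) u + (1 - x) * measure_pmf.expectation (k False) u"
  using assms by (subst pmf_expectation_bind[of UNIV]) (auto simp: UNIV_bool)

lemma sum_return_pmf: "(\<Sum>t\<in>UNIV. pmf (return_pmf (s::item)) t * (g t::real)) = g s"
  by (simp add: pmf_return sum.remove[of UNIV s])

lemma mean_length_0:
  assumes "\<And>s. 0 \<le> f \<theta> s" "\<And>s. f \<theta> s \<le> 1"
  shows "mean_length \<alpha> f \<theta> \<pi> 0 = (\<Sum>s\<in>UNIV. pmf (\<pi> []) s * (f \<theta> s / \<alpha> \<theta> s))"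
  unfolding mean_length_def using assms
  by (simp add: bind_return_pmf expectation_bind_item)

lemma mean_length_Suc:
  assumes "\<And>s. 0 \<le> f \<theta> s" "\<And>s. f \<theta> s \<le> 1"
  shows "mean_length \<alpha> f \<theta> \<pi> (Suc n) = (\<Sum>s\<in>UNIV. pmf (\<pi> []) s *
    (f \<theta> s * mean_length \<alpha> f \<theta> (continuation \<pi> (s, True)) n +
     (1 - f \<theta> s) * mean_length \<alpha> f \<theta> (continuation \<pi> (s, False)) n))"
proof -
  let ?l = "\<lambda>h. case last h of (s, y) \<Rightarrow> if y then 1 / \<alpha> \<theta> s else (0::real)"
  have "measure_pmf.expectation (history_pmf f \<theta> (continuation \<pi> x) (Suc n)) (\<lambda>h. ?l (x # h)) =
      mean_length \<alpha> f \<theta> (continuation \<pi> x) n" for x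
    unfolding mean_length_def
    by (intro integral_cong_AE) (auto simp: AE_measure_pmf_iff simp del: history_pmf.simps
        dest!: set_history_pmf)
  then show ?thesis
    unfolding mean_length_def[of \<alpha> f \<theta> \<pi>] history_pmf_first_step[of f \<theta> \<pi> "Suc n"]
    using assms
    by (simp add: expectation_bind_item expectation_bind_bernoulli finite_set_history_pmf
        del: history_pmf.simps)
qed

lemma favourite_eq:
  assumes "r \<theta> (other s) < r \<theta> s"
  shows "favourite r \<theta> = s"
proof -
  have "is_arg_max (r \<theta>) (\<lambda>_. True) t \<longleftrightarrow> t = s" for t
    unfolding is_arg_max_def using assms by (metis less_asym less_irrefl other_neq)
  then show ?thesis
    unfolding favourite_def arg_max_def by (intro some_equality) auto
qed

text \<open>
  What admissibility yields once the two items are treated symmetrically: the sure item need not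
  be the favourite one, as a type favouring \<open>Item_b\<close> may also play 1 on \<open>Item_a\<close>.
\<close>

locale committed_profile =
  fixes \<alpha> :: "'t::finite \<Rightarrow> item \<Rightarrow> real" and f :: "'t profile" and \<gamma> :: real
  assumes alpha_pos: "\<alpha> \<theta> s > 0"
    and gamma_nonneg: "0 \<le> \<gamma>" and gamma_less_1: "\<gamma> < 1"
    and f_nonneg: "0 \<le> f \<theta> s" and f_le_1: "f \<theta> s \<le> 1"
    and sure_item: "\<exists>s. f \<theta> s = 1 \<and> f \<theta> (other s) / \<alpha> \<theta> (other s) < 1 / \<alpha> \<theta> s"
begin

text \<open>
  Expected discounted length, for type \<open>\<theta>\<close>, of recommending \<open>s\<close> up to the first
  non-engagement and the other item ever after.
\<close>

definition commit_value :: "item \<Rightarrow> 't \<Rightarrow> real" where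
  "commit_value s \<theta> = (f \<theta> s / \<alpha> \<theta> s +
     \<gamma> * (1 - f \<theta> s) * (f \<theta> (other s) / \<alpha> \<theta> (other s)) / (1 - \<gamma>)) / (1 - \<gamma> * f \<theta> s)"

definition commit_total :: "item \<Rightarrow> 't belief \<Rightarrow> real" where
  "commit_total s q = (\<Sum>\<theta>\<in>UNIV. q \<theta> * commit_value s \<theta>)"

text \<open>
  Unnormalised posteriors: the algorithm's values are linear in the belief, so normalisation can
  wait until \<open>posterior\<close> itself is needed.
\<close>

definition hit :: "'t belief \<Rightarrow> item \<Rightarrow> 't belief" where
  "hit q s = (\<lambda>\<theta>. q \<theta> * f \<theta> s)"

definition miss :: "'t belief \<Rightarrow> item \<Rightarrow> 't belief" where
  "miss q s = (\<lambda>\<theta>. q \<theta> * (1 - f \<theta> s))"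

lemma gamma_f_less_1: "\<gamma> * f \<theta> s < 1"
  using mult_left_mono[OF f_le_1 gamma_nonneg, of \<theta> s] gamma_less_1 by simp

lemma commit_value_sure: "f \<theta> s = 1 \<Longrightarrow> commit_value s \<theta> = 1 / \<alpha> \<theta> s / (1 - \<gamma>)"
  by (simp add: commit_value_def)

lemma commit_value_switch:
  "commit_value s \<theta> = f \<theta> s / \<alpha> \<theta> s + \<gamma> * (f \<theta> s * commit_value s \<theta> +
     (1 - f \<theta> s) * (f \<theta> (other s) / \<alpha> \<theta> (other s) / (1 - \<gamma>)))"
  (is "?c = ?u + \<gamma> * (?p * ?c + (1 - ?p) * (?v / (1 - \<gamma>)))")
proof -
  have "?c * (1 - \<gamma> * ?p) = ?u + \<gamma> * (1 - ?p) * ?v / (1 - \<gamma>)"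
    using gamma_f_less_1[of \<theta> s] by (simp add: commit_value_def)
  then show ?thesis by (simp add: algebra_simps)
qed

lemma sure_other: "f \<theta> s < 1 \<Longrightarrow> f \<theta> (other s) = 1 \<and> f \<theta> s / \<alpha> \<theta> s < 1 / \<alpha> \<theta> (other s)"
proof -
  assume "f \<theta> s < 1"
  moreover obtain t where t: "f \<theta> t = 1" "f \<theta> (other t) / \<alpha> \<theta> (other t) < 1 / \<alpha> \<theta> t"
    using sure_item by blast
  ultimately have "t = other s" by (intro other_neq) auto
  then show ?thesis using t by simp
qed

lemma commit_value_rec:
  "commit_value s \<theta> = f \<theta> s / \<alpha> \<theta> s + \<gamma> * (f \<theta> s * commit_value s \<theta> +
     (1 - f \<theta> s) * commit_value (other s) \<theta>)"
proof (cases "f \<theta> s = 1")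
  case True
  then show ?thesis using commit_value_switch[of s \<theta>] by simp
next
  case False
  then have "f \<theta> (other s) = 1" using sure_other f_le_1 by (meson less_eq_real_def)
  then show ?thesis using commit_value_switch[of s \<theta>] commit_value_sure[of \<theta> "other s"] by simp
qed

lemma constant_le_commit_value: "f \<theta> s / \<alpha> \<theta> s \<le> (1 - \<gamma>) * commit_value s \<theta>"
  and commit_value_less_other: "f \<theta> s < 1 \<Longrightarrow> commit_value s \<theta> < commit_value (other s) \<theta>"
proof -
  let ?u = "f \<theta> s / \<alpha> \<theta> s" and ?v = "1 / \<alpha> \<theta> (other s)"
  have g: "1 - \<gamma> > 0" using gamma_less_1 by simp
  have *: "?u \<le> (1 - \<gamma>) * commit_value s \<theta>"
    "commit_value s \<theta> < ?v / (1 - \<gamma>)" if "f \<theta> s < 1"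
  proof -
    have uv: "?u < ?v" and f1: "f \<theta> (other s) = 1" using sure_other that by auto
    define c where "c = commit_value s \<theta>"
    have d: "1 - \<gamma> * f \<theta> s > 0" using gamma_f_less_1[of \<theta> s] by simp
    have c: "(1 - \<gamma>) * c * (1 - \<gamma> * f \<theta> s) = (1 - \<gamma>) * u + \<gamma> * (1 - f \<theta> s) * v"
      if "u = ?u" "v = ?v" for u v
    proof -
      have "c * (1 - \<gamma> * f \<theta> s) = u + \<gamma> * (1 - f \<theta> s) * v / (1 - \<gamma>)"
        using d f1 that by (simp add: c_def commit_value_def)
      then have "(1 - \<gamma>) * (c * (1 - \<gamma> * f \<theta> s)) =
          (1 - \<gamma>) * (u + \<gamma> * (1 - f \<theta> s) * v / (1 - \<gamma>))" by simp
      then show ?thesis using g by (simp add: distrib_left mult.assoc)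
    qed
    have e: "((1 - \<gamma>) * c - ?u) * (1 - \<gamma> * f \<theta> s) = \<gamma> * (1 - f \<theta> s) * (?v - ?u)"
      and e': "(?v - (1 - \<gamma>) * c) * (1 - \<gamma> * f \<theta> s) = (1 - \<gamma>) * (?v - ?u)"
      using c[OF refl refl] by algebra+
    have "(?v - (1 - \<gamma>) * c) * (1 - \<gamma> * f \<theta> s) > 0" unfolding e' using g uv by simp
    then have "?v - (1 - \<gamma>) * c > 0" using d by (simp add: zero_less_mult_iff)
    then show "commit_value s \<theta> < ?v / (1 - \<gamma>)"
      unfolding pos_less_divide_eq[OF g] c_def[symmetric] by (simp add: mult.commute)
    have "((1 - \<gamma>) * c - ?u) * (1 - \<gamma> * f \<theta> s) \<ge> 0"
      unfolding e using gamma_nonneg that uv by simp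
    then show "?u \<le> (1 - \<gamma>) * commit_value s \<theta>"
      using d by (simp add: c_def zero_le_mult_iff)
  qed
  show "commit_value s \<theta> < commit_value (other s) \<theta>" if "f \<theta> s < 1"
    using *(2)[OF that] commit_value_sure[of \<theta> "other s"] sure_other[OF that] by simp
  show "?u \<le> (1 - \<gamma>) * commit_value s \<theta>"
  proof (cases "f \<theta> s = 1")
    case True
    then show ?thesis using g by (simp add: commit_value_sure)
  next
    case False
    then show ?thesis using *(1) f_le_1[of \<theta> s] by fastforce
  qed
qed

lemma margin_weight_eq:
  "margin_weight \<alpha> \<gamma> f \<theta> = commit_value Item_a \<theta> - commit_value Item_b \<theta>"
proof -
  have *: "(1 - \<gamma>) / ((1 - \<gamma> * p) * (1 - \<gamma> * 1)) * (p / A - 1 / B) =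
      (p / A + \<gamma> * (1 - p) * (1 / B) / (1 - \<gamma>)) / (1 - \<gamma> * p) - 1 / B / (1 - \<gamma>)"
    if "1 - \<gamma> * p > 0" for p A B
  proof -
    define U V where "U = p / A" and "V = 1 / B"
    have "1 - \<gamma> > 0" using gamma_less_1 by simp
    then have "(1 - \<gamma>) / ((1 - \<gamma> * p) * (1 - \<gamma> * 1)) * (U - V) =
      (U + \<gamma> * (1 - p) * V / (1 - \<gamma>)) / (1 - \<gamma> * p) - V / (1 - \<gamma>)"
      using that by (simp add: divide_simps) (simp add: algebra_simps)
    then show ?thesis unfolding U_def V_def .
  qed
  have **: "(1 - \<gamma>) / ((1 - \<gamma> * 1) * (1 - \<gamma> * p)) * (1 / B - p / A) =
      1 / B / (1 - \<gamma>) - (p / A + \<gamma> * (1 - p) * (1 / B) / (1 - \<gamma>)) / (1 - \<gamma> * p)"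
    if "1 - \<gamma> * p > 0" for p A B
    unfolding mult.commute[of "1 - \<gamma> * 1"] minus_diff_eq[of "p / A" "1 / B", symmetric]
      mult_minus_right *[OF that] by (rule minus_diff_eq)
  have d: "1 - \<gamma> * f \<theta> s > 0" for s using gamma_f_less_1[of \<theta> s] by simp
  obtain s where s: "f \<theta> s = 1" using sure_item by blast
  show ?thesis
  proof (cases s)
    case Item_a
    then have f: "f \<theta> Item_a = 1" using s by simp
    show ?thesis
      unfolding margin_weight_def commit_value_sure[OF f] commit_value_def[of Item_b] other.simps f
      by (rule **[OF d])
  next
    case Item_b
    then have f: "f \<theta> Item_b = 1" using s by simp
    show ?thesis
      unfolding margin_weight_def commit_value_sure[OF f] commit_value_def[of Item_a] other.simps f
      by (rule *[OF d])
  qed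
qed

lemma commit_total_rec:
  "commit_total s q = (\<Sum>\<theta>\<in>UNIV. q \<theta> * (f \<theta> s / \<alpha> \<theta> s)) +
     \<gamma> * (commit_total s (hit q s) + commit_total (other s) (miss q s))"
proof -
  have "q \<theta> * commit_value s \<theta> = q \<theta> * (f \<theta> s / \<alpha> \<theta> s) +
      \<gamma> * (hit q s \<theta> * commit_value s \<theta> + miss q s \<theta> * commit_value (other s) \<theta>)" for \<theta>
    by (subst commit_value_rec[of s \<theta>]) (simp add: hit_def miss_def algebra_simps)
  then show ?thesis
    unfolding commit_total_def by (simp only: sum.distrib sum_distrib_left[symmetric])
qed

lemma commit_total_hit_miss:
  "commit_total t (hit q s) + commit_total t (miss q s) = commit_total t q"
  unfolding commit_total_def hit_def miss_def sum.distrib[symmetric]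
  by (intro sum.cong refl) (simp add: algebra_simps)

lemma constant_le_commit_total:
  assumes "\<forall>\<theta>. q \<theta> \<ge> 0"
  shows "(\<Sum>\<theta>\<in>UNIV. q \<theta> * (f \<theta> s / \<alpha> \<theta> s)) \<le> (1 - \<gamma>) * commit_total s q"
  unfolding commit_total_def sum_distrib_left
  using mult_left_mono[OF constant_le_commit_value assms[rule_format]]
  by (intro sum_mono) (simp add: mult.left_commute)

lemma hit_nonneg: "\<forall>\<theta>. q \<theta> \<ge> 0 \<Longrightarrow> \<forall>\<theta>. hit q s \<theta> \<ge> 0"
  and miss_nonneg: "\<forall>\<theta>. q \<theta> \<ge> 0 \<Longrightarrow> \<forall>\<theta>. miss q s \<theta> \<ge> 0"
  by (simp_all add: hit_def miss_def f_nonneg f_le_1)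

lemma miss_commit_value_le:
  assumes "\<forall>\<theta>. q \<theta> \<ge> 0"
  shows "miss q s \<theta> * commit_value s \<theta> \<le> miss q s \<theta> * commit_value (other s) \<theta>"
  using commit_value_less_other[of \<theta> s] miss_nonneg[of q s, OF assms] f_le_1[of \<theta> s]
  by (cases "f \<theta> s = 1") (auto simp: miss_def intro!: mult_left_mono)

lemma commit_total_miss_le:
  assumes "\<forall>\<theta>. q \<theta> \<ge> 0"
  shows "commit_total s (miss q s) \<le> commit_total (other s) (miss q s)"
  unfolding commit_total_def by (intro sum_mono miss_commit_value_le assms)

definition best_commit :: "'t belief \<Rightarrow> real" where
  "best_commit q = max (commit_total Item_a q) (commit_total Item_b q)"

lemma best_commit_eq: "best_commit q = max (commit_total s q) (commit_total (other s) q)"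
  by (cases s) (auto simp: best_commit_def)

definition bellman :: "item \<Rightarrow> 't belief \<Rightarrow> real" where
  "bellman s q = (\<Sum>\<theta>\<in>UNIV. q \<theta> * (f \<theta> s / \<alpha> \<theta> s)) +
     \<gamma> * (best_commit (hit q s) + best_commit (miss q s))"

text \<open>
  After a non-engagement with \<open>s\<close> the other item is optimal, so only the continuation after an
  engagement needs a case distinction.
\<close>

lemma bellman_le:
  assumes "\<forall>\<theta>. q \<theta> \<ge> 0"
  shows "bellman s q \<le> max (commit_total s q)
    ((1 - \<gamma>) * commit_total s q + \<gamma> * commit_total (other s) q)"
proof -
  have m: "best_commit (miss q s) = commit_total (other s) (miss q s)"
    using commit_total_miss_le[OF assms, of s] by (simp add: best_commit_eq[of _ s])
  show ?thesis
  proof (cases "commit_total (other s) (hit q s) \<le> commit_total s (hit q s)")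
    case True
    then have "best_commit (hit q s) = commit_total s (hit q s)"
      by (simp add: best_commit_eq[of _ s])
    then show ?thesis using commit_total_rec[of s q] by (simp add: bellman_def m)
  next
    case False
    then have "best_commit (hit q s) = commit_total (other s) (hit q s)"
      by (simp add: best_commit_eq[of _ s])
    then show ?thesis
      using constant_le_commit_total[OF assms, of s] commit_total_hit_miss[of "other s" q s]
      by (simp add: bellman_def m)
  qed
qed

lemma bellman_le_best_commit:
  assumes "\<forall>\<theta>. q \<theta> \<ge> 0"
  shows "bellman s q \<le> best_commit q"
proof -
  have "(1 - \<gamma>) * commit_total s q + \<gamma> * commit_total (other s) q
      \<le> (1 - \<gamma>) * best_commit q + \<gamma> * best_commit q"
    using gamma_nonneg gamma_less_1
    by (intro add_mono mult_left_mono) (auto simp: best_commit_eq[of _ s])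
  then show ?thesis
    using bellman_le[OF assms, of s] by (auto simp: best_commit_eq[of _ s] algebra_simps)
qed

lemma bellman_less:
  assumes "\<forall>\<theta>. q \<theta> \<ge> 0" "commit_total s q < commit_total (other s) q"
  shows "bellman s q < commit_total (other s) q"
proof -
  have "(1 - \<gamma>) * commit_total s q < (1 - \<gamma>) * commit_total (other s) q"
    using assms(2) gamma_less_1 by simp
  then show ?thesis
    using bellman_le[OF assms(1), of s] assms(2) by (auto simp: algebra_simps)
qed

lemmas mean_length_rec =
  mean_length_0[where f = f, OF f_nonneg f_le_1] mean_length_Suc[where f = f, OF f_nonneg f_le_1]

definition type_value :: "nat \<Rightarrow> policy \<Rightarrow> 't \<Rightarrow> real" where
  "type_value n \<pi> \<theta> = (\<Sum>k<n. \<gamma> ^ k * mean_length \<alpha> f \<theta> \<pi> k)"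

definition horizon_value :: "nat \<Rightarrow> policy \<Rightarrow> 't belief \<Rightarrow> real" where
  "horizon_value n \<pi> q = (\<Sum>\<theta>\<in>UNIV. q \<theta> * type_value n \<pi> \<theta>)"

lemma type_value_Suc:
  "type_value (Suc n) \<pi> \<theta> = (\<Sum>s\<in>UNIV. pmf (\<pi> []) s * (f \<theta> s / \<alpha> \<theta> s +
     \<gamma> * (f \<theta> s * type_value n (continuation \<pi> (s, True)) \<theta> +
          (1 - f \<theta> s) * type_value n (continuation \<pi> (s, False)) \<theta>)))"
proof -
  have "type_value (Suc n) \<pi> \<theta> =
      mean_length \<alpha> f \<theta> \<pi> 0 + \<gamma> * (\<Sum>k<n. \<gamma> ^ k * mean_length \<alpha> f \<theta> \<pi> (Suc k))"
    unfolding type_value_def sum.lessThan_Suc_shift by (simp add: sum_distrib_left mult.assoc)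
  also have "(\<Sum>k<n. \<gamma> ^ k * mean_length \<alpha> f \<theta> \<pi> (Suc k)) = (\<Sum>s\<in>UNIV. pmf (\<pi> []) s *
      (f \<theta> s * type_value n (continuation \<pi> (s, True)) \<theta> +
       (1 - f \<theta> s) * type_value n (continuation \<pi> (s, False)) \<theta>))"
    unfolding mean_length_rec sum_distrib_left type_value_def
    by (subst sum.swap, intro sum.cong refl)
      (simp only: sum_distrib_left distrib_left sum.distrib mult_ac)
  finally show ?thesis
    by (simp only: mean_length_rec sum_distrib_left distrib_left sum.distrib mult_ac)
qed

lemma horizon_value_Suc:
  "horizon_value (Suc n) \<pi> q = (\<Sum>s\<in>UNIV. pmf (\<pi> []) s *
     ((\<Sum>\<theta>\<in>UNIV. q \<theta> * (f \<theta> s / \<alpha> \<theta> s)) +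
      \<gamma> * (horizon_value n (continuation \<pi> (s, True)) (hit q s) +
           horizon_value n (continuation \<pi> (s, False)) (miss q s))))"
  unfolding horizon_value_def type_value_Suc sum_distrib_left
  by (subst sum.swap, intro sum.cong refl)
    (simp only: hit_def miss_def sum_distrib_left distrib_left sum.distrib mult_ac)

lemma commit_value_nonneg: "commit_value s \<theta> \<ge> 0"
proof -
  have "f \<theta> s / \<alpha> \<theta> s \<ge> 0" using f_nonneg alpha_pos by (simp add: less_imp_le)
  then show ?thesis
    using constant_le_commit_value[of \<theta> s] gamma_less_1
    by (smt (verit) mult_pos_neg)
qed

lemma best_commit_nonneg: "\<forall>\<theta>. q \<theta> \<ge> 0 \<Longrightarrow> best_commit q \<ge> 0"
  unfolding best_commit_def commit_total_def
  by (intro max.coboundedI1 sum_nonneg mult_nonneg_nonneg commit_value_nonneg) auto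

lemma horizon_value_le:
  assumes "\<forall>\<theta>. q \<theta> \<ge> 0"
  shows "horizon_value n \<pi> q \<le> best_commit q"
    and "horizon_value (Suc n) \<pi> q \<le> (\<Sum>s\<in>UNIV. pmf (\<pi> []) s * bellman s q)"
proof -
  have step: "horizon_value (Suc n) \<pi> q \<le> (\<Sum>s\<in>UNIV. pmf (\<pi> []) s * bellman s q)"
    if "\<And>\<pi> q. \<forall>\<theta>. q \<theta> \<ge> 0 \<Longrightarrow> horizon_value n \<pi> q \<le> best_commit q"
      "\<forall>\<theta>. q \<theta> \<ge> 0" for n \<pi> q
    unfolding horizon_value_Suc bellman_def using gamma_nonneg that
    by (intro sum_mono mult_left_mono add_mono that(1) order_refl)
      (auto intro: hit_nonneg[rule_format] miss_nonneg[rule_format])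
  have le: "horizon_value n \<pi> q \<le> best_commit q" if "\<forall>\<theta>. q \<theta> \<ge> 0" for n \<pi> q
    using that
  proof (induction n arbitrary: \<pi> q)
    case 0
    then show ?case by (simp add: horizon_value_def type_value_def best_commit_nonneg)
  next
    case (Suc n)
    have "horizon_value (Suc n) \<pi> q \<le> (\<Sum>s\<in>UNIV. pmf (\<pi> []) s * bellman s q)"
      using Suc by (intro step) auto
    also have "\<dots> \<le> (\<Sum>s\<in>UNIV. pmf (\<pi> []) s * best_commit q)"
      by (intro sum_mono mult_left_mono bellman_le_best_commit Suc.prems) auto
    also have "\<dots> = best_commit q"
      by (simp add: sum_distrib_right[symmetric] sum_pmf_eq_1)
    finally show ?case .
  qed
  show "horizon_value n \<pi> q \<le> best_commit q" by (rule le[OF assms])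
  show "horizon_value (Suc n) \<pi> q \<le> (\<Sum>s\<in>UNIV. pmf (\<pi> []) s * bellman s q)"
    by (rule step[OF le assms])
qed

lemma mean_length_bounds: "0 \<le> mean_length \<alpha> f \<theta> \<pi> n \<and>
  mean_length \<alpha> f \<theta> \<pi> n \<le> (\<Sum>s\<in>UNIV. 1 / \<alpha> \<theta> s)"
  unfolding mean_length_def
proof (intro conjI Bochner_Integration.integral_nonneg measure_pmf.integral_le_const
    integrable_measure_pmf_finite finite_set_history_pmf AE_pmfI)
  show "0 \<le> (case last h of (s, y) \<Rightarrow> if y then 1 / \<alpha> \<theta> s else 0)" for h
    using alpha_pos by (auto split: prod.split simp: less_imp_le)
  have "0 \<le> (\<Sum>s\<in>UNIV. 1 / \<alpha> \<theta> s)"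
    using alpha_pos by (intro sum_nonneg) (auto simp: less_imp_le)
  moreover have "1 / \<alpha> \<theta> s \<le> (\<Sum>s\<in>UNIV. 1 / \<alpha> \<theta> s)" for s
    using alpha_pos by (intro member_le_sum) (auto simp: less_imp_le)
  ultimately show "(case last h of (s, y) \<Rightarrow> if y then 1 / \<alpha> \<theta> s else 0) \<le> (\<Sum>s\<in>UNIV. 1 / \<alpha> \<theta> s)"
    for h by (auto split: prod.split)
qed

lemma summable_mean_length: "summable (\<lambda>n. \<gamma> ^ n * mean_length \<alpha> f \<theta> \<pi> n)"
proof (rule summable_comparison_test')
  show "summable (\<lambda>n. \<gamma> ^ n * (\<Sum>s\<in>UNIV. 1 / \<alpha> \<theta> s))"
    using gamma_nonneg gamma_less_1 by (intro summable_mult2 summable_geometric) simp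
  show "norm (\<gamma> ^ n * mean_length \<alpha> f \<theta> \<pi> n) \<le> \<gamma> ^ n * (\<Sum>s\<in>UNIV. 1 / \<alpha> \<theta> s)" for n
    using gamma_nonneg mean_length_bounds[of \<theta> \<pi> n]
    by (auto simp: abs_mult intro!: mult_left_mono)
qed

lemma horizon_value_limit: "(\<lambda>n. horizon_value n \<pi> q) \<longlonglongrightarrow> policy_value \<alpha> \<gamma> f q \<pi>"
  unfolding horizon_value_def policy_value_def type_value_def
  by (intro tendsto_sum tendsto_mult tendsto_const summable_LIMSEQ summable_mean_length)

lemma policy_value_le_bellman:
  assumes "\<forall>\<theta>. q \<theta> \<ge> 0" "\<pi> [] = return_pmf s"
  shows "policy_value \<alpha> \<gamma> f q \<pi> \<le> bellman s q"
proof (rule LIMSEQ_le_const2)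
  show "(\<lambda>n. horizon_value (Suc n) \<pi> q) \<longlonglongrightarrow> policy_value \<alpha> \<gamma> f q \<pi>"
    by (rule LIMSEQ_Suc[OF horizon_value_limit])
  have "(\<Sum>t\<in>UNIV. pmf (\<pi> []) t * bellman t q) = bellman s q"
    unfolding assms(2) by (rule sum_return_pmf)
  then show "\<exists>N. \<forall>n\<ge>N. horizon_value (Suc n) \<pi> q \<le> bellman s q"
    using horizon_value_le(2)[OF assms(1)] by metis
qed

definition commit_policy :: "item \<Rightarrow> policy" where
  "commit_policy s h = return_pmf (if (s, False) \<in> set h then other s else s)"

lemma mean_length_const: "mean_length \<alpha> f \<theta> (\<lambda>_. return_pmf s) n = f \<theta> s / \<alpha> \<theta> s"
proof (induction n)
  case 0
  show ?case unfolding mean_length_rec sum_return_pmf ..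
next
  case (Suc n)
  then show ?case
    unfolding mean_length_rec sum_return_pmf continuation_def
    by (simp add: distrib_right[symmetric] del: times_divide_eq_right)
qed

lemma policy_value_commit_policy:
  "policy_value \<alpha> \<gamma> f q (commit_policy s) = commit_total s q"
proof -
  have ct: "continuation (commit_policy s) (s, True) = commit_policy s"
    and cf: "continuation (commit_policy s) (s, False) = (\<lambda>_. return_pmf (other s))"
    and c0: "commit_policy s [] = return_pmf s"
    by (auto simp: continuation_def commit_policy_def fun_eq_iff)
  have "(\<Sum>n. \<gamma> ^ n * mean_length \<alpha> f \<theta> (commit_policy s) n) = commit_value s \<theta>" for \<theta>
  proof -
    define M where "M = mean_length \<alpha> f \<theta> (commit_policy s)"
    define v where "v = f \<theta> (other s) / \<alpha> \<theta> (other s)"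
    have M0: "M 0 = f \<theta> s / \<alpha> \<theta> s"
      unfolding M_def mean_length_rec c0 sum_return_pmf ..
    have MS: "M (Suc n) = f \<theta> s * M n + (1 - f \<theta> s) * v" for n
      unfolding M_def mean_length_rec c0 sum_return_pmf ct cf
        mean_length_const v_def ..
    have sm: "summable (\<lambda>n. \<gamma> ^ n * M n)" unfolding M_def by (rule summable_mean_length)
    have geo: "(\<lambda>n. \<gamma> ^ n) sums (1 / (1 - \<gamma>))"
      using gamma_nonneg gamma_less_1 by (intro geometric_sums) simp
    define X where "X = (\<Sum>n. \<gamma> ^ n * M n)"
    have "(\<lambda>n. \<gamma> * (f \<theta> s * (\<gamma> ^ n * M n) + (1 - f \<theta> s) * v * \<gamma> ^ n)) sums
        (\<gamma> * (f \<theta> s * X + (1 - f \<theta> s) * v * (1 / (1 - \<gamma>))))"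
      unfolding X_def by (intro sums_mult sums_add summable_sums sm geo)
    then have "(\<lambda>n. \<gamma> ^ Suc n * M (Suc n)) sums
        (\<gamma> * (f \<theta> s * X + (1 - f \<theta> s) * v * (1 / (1 - \<gamma>))))"
      by (simp add: MS algebra_simps)
    then have "X = M 0 + \<gamma> * (f \<theta> s * X + (1 - f \<theta> s) * v * (1 / (1 - \<gamma>)))"
      using suminf_split_head[OF sm] by (simp add: X_def sums_iff)
    moreover define w where "w = v * (1 / (1 - \<gamma>))"
    ultimately have "X = M 0 + \<gamma> * (f \<theta> s * X + (1 - f \<theta> s) * w)"
      by (simp only: mult.assoc)
    then have "X * (1 - \<gamma> * f \<theta> s) = M 0 + \<gamma> * (1 - f \<theta> s) * w"
      by algebra
    then have "X * (1 - \<gamma> * f \<theta> s) = f \<theta> s / \<alpha> \<theta> s + \<gamma> * (1 - f \<theta> s) * v / (1 - \<gamma>)"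
      unfolding M0 w_def by simp
    then show ?thesis
      using gamma_f_less_1[of \<theta> s]
      by (simp add: commit_value_def v_def[symmetric] X_def[symmetric] M_def[symmetric] eq_divide_eq)
  qed
  then show ?thesis by (simp add: policy_value_def commit_total_def)
qed

lemma Q_alg_bounds:
  assumes "\<forall>\<theta>. q \<theta> \<ge> 0"
  shows "commit_total s q \<le> Q_alg \<alpha> \<gamma> f q s" and "Q_alg \<alpha> \<gamma> f q s \<le> bellman s q"
proof -
  have mem: "commit_policy s \<in> {\<pi>. \<pi> [] = return_pmf s}" by (simp add: commit_policy_def)
  have le: "policy_value \<alpha> \<gamma> f q \<pi> \<le> bellman s q" if "\<pi> \<in> {\<pi>. \<pi> [] = return_pmf s}" for \<pi>
    using that assms by (intro policy_value_le_bellman) auto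
  show "Q_alg \<alpha> \<gamma> f q s \<le> bellman s q"
    unfolding Q_alg_def using mem by (intro cSUP_least le) auto
  show "commit_total s q \<le> Q_alg \<alpha> \<gamma> f q s"
    unfolding Q_alg_def policy_value_commit_policy[symmetric]
    by (intro cSUP_upper mem bdd_aboveI2[where M = "bellman s q"] le)
qed

lemma recommends:
  assumes "best_responding \<alpha> \<gamma> \<sigma>" "\<forall>\<theta>. q \<theta> \<ge> 0"
    and "commit_total (other s) q < commit_total s q"
  shows "\<sigma> f q = s"
proof (rule ccontr)
  assume "\<sigma> f q \<noteq> s"
  then have "\<sigma> f q = other s" using other_neq by metis
  then have "Q_alg \<alpha> \<gamma> f q s \<le> Q_alg \<alpha> \<gamma> f q (other s)"
    using assms(1) by (simp add: best_responding_def is_arg_max_def linorder_not_less) metis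
  then show False
    using Q_alg_bounds(1)[OF assms(2), of s] Q_alg_bounds(2)[OF assms(2), of "other s"]
      bellman_less[OF assms(2), of "other s"] assms(3) by simp
qed

lemma commit_total_divide: "commit_total s (\<lambda>\<theta>. q \<theta> / c) = commit_total s q / c"
  by (simp add: commit_total_def sum_divide_distrib)

lemma posterior_True: "posterior f q s True = (\<lambda>\<theta>. hit q s \<theta> / sum (hit q s) UNIV)"
  and posterior_False: "posterior f q s False = (\<lambda>\<theta>. miss q s \<theta> / sum (miss q s) UNIV)"
  by (simp_all add: posterior_def hit_def miss_def)

lemma sum_pos_of_pos:
  fixes q :: "'t belief"
  assumes "\<forall>\<theta>. q \<theta> \<ge> 0" "q \<theta> > 0"
  shows "sum q UNIV > 0"
  using assms by (intro sum_pos2[of _ \<theta>]) auto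

lemma commit_total_hit_less:
  assumes "\<forall>\<theta>. q \<theta> \<ge> 0" "commit_total (other s) q < commit_total s q"
  shows "commit_total (other s) (hit q s) < commit_total s (hit q s)"
  using commit_total_hit_miss[of s q s] commit_total_hit_miss[of "other s" q s]
    commit_total_miss_le[OF assms(1), of s] assms(2) by simp

lemma commit_total_miss_less:
  assumes "\<forall>\<theta>. q \<theta> \<ge> 0" "q \<theta> > 0" "f \<theta> s < 1"
  shows "commit_total s (miss q s) < commit_total (other s) (miss q s)"
  unfolding commit_total_def
proof (rule sum_strict_mono_ex1)
  show "\<forall>\<theta>\<in>UNIV. miss q s \<theta> * commit_value s \<theta> \<le> miss q s \<theta> * commit_value (other s) \<theta>"
    using miss_commit_value_le[OF assms(1)] by blast
  show "\<exists>\<theta>\<in>UNIV. miss q s \<theta> * commit_value s \<theta> < miss q s \<theta> * commit_value (other s) \<theta>"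
    using assms(2,3) commit_value_less_other[of \<theta> s]
    by (intro bexI[of _ \<theta>]) (auto simp: miss_def)
qed simp

end

lemma Q_user_rec:
  assumes "0 \<le> \<gamma>H" "\<gamma>H < 1" "0 \<le> f \<theta> s" "f \<theta> s \<le> 1"
  shows "Q_user r \<gamma>H \<sigma> f \<theta> q s = f \<theta> s * r \<theta> s + \<gamma>H *
    (f \<theta> s * Q_user r \<gamma>H \<sigma> f \<theta> (posterior f q s True) (\<sigma> f (posterior f q s True)) +
     (1 - f \<theta> s) * Q_user r \<gamma>H \<sigma> f \<theta> (posterior f q s False) (\<sigma> f (posterior f q s False)))"
proof -
  have "user_bellman r \<gamma>H \<sigma> f \<theta> (Q_user r \<gamma>H \<sigma> f \<theta>)"
    unfolding Q_user_def using theI'[OF user_value_ex1[OF assms(1,2), of r \<sigma> f \<theta>]] by blast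
  then have "Q_user r \<gamma>H \<sigma> f \<theta> q s = f \<theta> s * r \<theta> s + \<gamma>H *
      measure_pmf.expectation (bernoulli_pmf (f \<theta> s)) (\<lambda>y.
        Q_user r \<gamma>H \<sigma> f \<theta> (posterior f q s y) (\<sigma> f (posterior f q s y)))"
    unfolding user_bellman_def by blast
  then show ?thesis
    using assms(3,4) by (simp add: mult.commute)
qed

lemma Q_user_bounded:
  assumes "0 \<le> \<gamma>H" "\<gamma>H < 1"
  obtains B where "\<And>q s. \<bar>Q_user r \<gamma>H \<sigma> f \<theta> q s\<bar> \<le> B"
  unfolding Q_user_def using theI'[OF user_value_ex1[OF assms, of r \<sigma> f \<theta>]] by blast

definition switch_payoff :: "real \<Rightarrow> real \<Rightarrow> real \<Rightarrow> real \<Rightarrow> real" where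
  "switch_payoff \<gamma> u v x = (x * u + \<gamma> * (1 - x) * v / (1 - \<gamma>)) / (1 - \<gamma> * x)"

lemma switch_payoff_rec:
  assumes "\<gamma> * x < 1"
  shows "switch_payoff \<gamma> u v x =
    x * u + \<gamma> * (x * switch_payoff \<gamma> u v x + (1 - x) * (v / (1 - \<gamma>)))"
proof -
  define w where "w = v / (1 - \<gamma>)"
  have "switch_payoff \<gamma> u v x * (1 - \<gamma> * x) = x * u + \<gamma> * (1 - x) * w"
    using assms by (simp add: switch_payoff_def w_def)
  then have "switch_payoff \<gamma> u v x = x * u + \<gamma> * (x * switch_payoff \<gamma> u v x + (1 - x) * w)"
    by algebra
  then show ?thesis by (simp add: w_def)
qed

lemma switch_payoff_less:
  assumes "0 \<le> \<gamma>" "\<gamma> < 1" "0 \<le> x" "x \<le> 1"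
  shows "\<gamma> * v < u \<Longrightarrow> x < 1 \<Longrightarrow> switch_payoff \<gamma> u v x < switch_payoff \<gamma> u v 1"
    and "u < \<gamma> * v \<Longrightarrow> 0 < x \<Longrightarrow> switch_payoff \<gamma> u v x < switch_payoff \<gamma> u v 0"
proof -
  have g: "1 - \<gamma> > 0" using assms by simp
  have d: "1 - \<gamma> * x > 0"
    using assms mult_left_mono[of x 1 \<gamma>] by simp
  have "switch_payoff \<gamma> u v 1 - switch_payoff \<gamma> u v x =
      (1 - x) * (u - \<gamma> * v) / ((1 - \<gamma>) * (1 - \<gamma> * x))"
    using g d by (simp add: switch_payoff_def divide_simps) (simp add: algebra_simps)
  moreover have "(1 - x) * (u - \<gamma> * v) / ((1 - \<gamma>) * (1 - \<gamma> * x)) > 0" if "\<gamma> * v < u" "x < 1"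
    using g d that by simp
  ultimately show "\<gamma> * v < u \<Longrightarrow> x < 1 \<Longrightarrow> switch_payoff \<gamma> u v x < switch_payoff \<gamma> u v 1"
    by simp
  have "switch_payoff \<gamma> u v 0 - switch_payoff \<gamma> u v x = x * (\<gamma> * v - u) / (1 - \<gamma> * x)"
    using g d by (simp add: switch_payoff_def divide_simps) (simp add: algebra_simps)
  moreover have "x * (\<gamma> * v - u) / (1 - \<gamma> * x) > 0" if "u < \<gamma> * v" "0 < x"
    using d that by simp
  ultimately show "u < \<gamma> * v \<Longrightarrow> 0 < x \<Longrightarrow> switch_payoff \<gamma> u v x < switch_payoff \<gamma> u v 0"
    by simp
qed

context committed_profile
begin

lemma Q_user_after_miss:
  assumes "best_responding \<alpha> \<gamma> \<sigma>" "0 \<le> \<gamma>H" "\<gamma>H < 1"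
    and q: "\<forall>\<theta>. q \<theta> \<ge> 0" "q \<theta> > 0" and miss: "f \<theta> s < 1"
  defines "p \<equiv> posterior f q s False"
  shows "Q_user r \<gamma>H \<sigma> f \<theta> p (\<sigma> f p) = r \<theta> (other s) / (1 - \<gamma>H)"
proof -
  have p: "p = (\<lambda>\<theta>. miss q s \<theta> / sum (miss q s) UNIV)"
    by (simp add: p_def posterior_False)
  have nonneg: "\<forall>\<theta>. miss q s \<theta> \<ge> 0" by (rule miss_nonneg[OF q(1)])
  have pos: "sum (miss q s) UNIV > 0"
    using sum_pos_of_pos[OF nonneg, of \<theta>] q(2) miss by (simp add: miss_def)
  have \<sigma>: "\<sigma> f p = other s"
  proof (rule recommends[OF assms(1)])
    show "\<forall>\<theta>. p \<theta> \<ge> 0" using nonneg pos by (simp add: p)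
    show "commit_total (other (other s)) p < commit_total (other s) p"
      using commit_total_miss_less[OF q miss] pos
      by (simp add: p commit_total_divide divide_strict_right_mono)
  qed
  have "hit p (other s) = p"
  proof
    fix \<theta>'
    show "hit p (other s) \<theta>' = p \<theta>'"
      using sure_other[of \<theta>' s] f_le_1[of \<theta>' s]
      by (cases "f \<theta>' s = 1") (auto simp: hit_def p miss_def)
  qed
  moreover have "sum p UNIV = 1" using pos by (simp add: p sum_divide_distrib[symmetric])
  ultimately have "posterior f p (other s) True = p" by (simp add: posterior_True)
  moreover have "f \<theta> (other s) = 1" using sure_other miss by blast
  ultimately have "Q_user r \<gamma>H \<sigma> f \<theta> p (other s) =
      r \<theta> (other s) + \<gamma>H * Q_user r \<gamma>H \<sigma> f \<theta> p (other s)"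
    using Q_user_rec[where f = f and \<theta> = \<theta> and s = "other s" and q = p and r = r and \<sigma> = \<sigma>,
        OF assms(2,3) f_nonneg f_le_1]
    by (simp only: \<sigma>) simp
  then have "Q_user r \<gamma>H \<sigma> f \<theta> p (other s) * (1 - \<gamma>H) = r \<theta> (other s)"
    by algebra
  then show ?thesis
    using assms(3) by (simp add: \<sigma> eq_divide_eq)
qed

lemma Q_user_eq:
  assumes "best_responding \<alpha> \<gamma> \<sigma>" "0 \<le> \<gamma>H" "\<gamma>H < 1"
    and "\<forall>\<theta>. q \<theta> \<ge> 0" "q \<theta> > 0" "commit_total (other s) q < commit_total s q"
  shows "Q_user r \<gamma>H \<sigma> f \<theta> q s = switch_payoff \<gamma>H (r \<theta> s) (r \<theta> (other s)) (f \<theta> s)"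
proof -
  define U where "U = switch_payoff \<gamma>H (r \<theta> s) (r \<theta> (other s)) (f \<theta> s)"
  let ?Q = "Q_user r \<gamma>H \<sigma> f \<theta>"
  obtain B where B: "\<And>q s. \<bar>?Q q s\<bar> \<le> B"
    using Q_user_bounded[OF assms(2,3), of r \<sigma> f \<theta>] by blast
  have fg: "\<gamma>H * f \<theta> s < 1"
    using mult_left_mono[OF f_le_1 assms(2), of \<theta> s] assms(3) by simp
  have "\<bar>?Q q s - U\<bar> \<le> \<gamma>H ^ n * (B + \<bar>U\<bar>)" for n
    using assms(4-6)
  proof (induction n arbitrary: q)
    case 0
    show ?case using B[of q s] by simp
  next
    case (Suc n)
    define p where "p = posterior f q s True"
    have F: "(1 - f \<theta> s) * ?Q (posterior f q s False) (\<sigma> f (posterior f q s False)) =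
        (1 - f \<theta> s) * (r \<theta> (other s) / (1 - \<gamma>H))"
      using Q_user_after_miss[OF assms(1-3) Suc.prems(1,2)] f_le_1[of \<theta> s] by (cases "f \<theta> s = 1") auto
    have T: "\<bar>f \<theta> s * (?Q p (\<sigma> f p) - U)\<bar> \<le> \<gamma>H ^ n * (B + \<bar>U\<bar>)"
    proof (cases "f \<theta> s = 0")
      case True
      have "B \<ge> 0" using B[of q s] by (meson abs_ge_zero order_trans)
      then show ?thesis using True assms(2) by simp
    next
      case False
      have p: "p = (\<lambda>\<theta>. hit q s \<theta> / sum (hit q s) UNIV)"
        by (simp add: p_def posterior_True)
      have nonneg: "\<forall>\<theta>. hit q s \<theta> \<ge> 0" by (rule hit_nonneg[OF Suc.prems(1)])
      have hp: "hit q s \<theta> > 0"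
        using Suc.prems(2) False f_nonneg[of \<theta> s] by (simp add: hit_def)
      have pos: "sum (hit q s) UNIV > 0" by (rule sum_pos_of_pos[OF nonneg hp])
      have p_nonneg: "\<forall>\<theta>. p \<theta> \<ge> 0" using nonneg pos by (simp add: p)
      have less: "commit_total (other s) p < commit_total s p"
        using commit_total_hit_less[OF Suc.prems(1,3)] pos
        by (simp add: p commit_total_divide divide_strict_right_mono)
      have "\<bar>?Q p s - U\<bar> \<le> \<gamma>H ^ n * (B + \<bar>U\<bar>)"
        using p_nonneg hp pos less by (intro Suc.IH) (simp_all add: p)
      moreover have "\<sigma> f p = s" by (rule recommends[OF assms(1) p_nonneg less])
      moreover have "\<bar>f \<theta> s * (?Q p s - U)\<bar> \<le> \<bar>?Q p s - U\<bar>"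
        using f_nonneg[of \<theta> s] f_le_1[of \<theta> s] by (simp add: abs_mult mult_left_le_one_le)
      ultimately show ?thesis by simp
    qed
    have "?Q q s = f \<theta> s * r \<theta> s + \<gamma>H * (f \<theta> s * ?Q p (\<sigma> f p) +
        (1 - f \<theta> s) * (r \<theta> (other s) / (1 - \<gamma>H)))"
      using Q_user_rec[where f = f and \<theta> = \<theta> and s = s and q = q and r = r and \<sigma> = \<sigma>,
          OF assms(2,3) f_nonneg f_le_1] unfolding F p_def .
    moreover have "U = f \<theta> s * r \<theta> s + \<gamma>H * (f \<theta> s * U +
        (1 - f \<theta> s) * (r \<theta> (other s) / (1 - \<gamma>H)))"
      unfolding U_def by (rule switch_payoff_rec[OF fg])
    ultimately have "?Q q s - U = \<gamma>H * (f \<theta> s * (?Q p (\<sigma> f p) - U))"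
      by algebra
    then show ?case
      using mult_left_mono[OF T assms(2)] assms(2) by (simp add: abs_mult mult.assoc)
  qed
  moreover have "(\<lambda>n. \<gamma>H ^ n * (B + \<bar>U\<bar>)) \<longlonglongrightarrow> 0"
    using assms(2,3) by (intro tendsto_mult_left_zero LIMSEQ_power_zero) simp
  ultimately have "\<bar>?Q q s - U\<bar> \<le> 0"
    by (meson LIMSEQ_le_const)
  then show ?thesis by (simp add: U_def)
qed

lemma margin_weight_ge:
  assumes "f \<theta> Item_b = 1" "1 / \<alpha> \<theta> Item_b < 1 / \<alpha> \<theta> Item_a"
  shows "- (1 / \<alpha> \<theta> Item_b) \<le> margin_weight \<alpha> \<gamma> f \<theta>"
proof -
  let ?x = "f \<theta> Item_a" and ?v = "1 / \<alpha> \<theta> Item_b"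
    and ?a = "commit_value Item_a \<theta>" and ?b = "commit_value Item_b \<theta>"
  have "?b = ?v + \<gamma> * ?b" "?a = ?x / \<alpha> \<theta> Item_a + \<gamma> * (?x * ?a + (1 - ?x) * ?b)"
    using commit_value_rec[of Item_b \<theta>] commit_value_rec[of Item_a \<theta>] assms(1) by simp_all
  then have e: "(?a - ?b + ?v) * (1 - \<gamma> * ?x) = ?x / \<alpha> \<theta> Item_a - \<gamma> * ?x * ?v"
    by algebra
  have "\<gamma> * ?x * ?v \<le> ?x * (1 / \<alpha> \<theta> Item_a)"
    using gamma_nonneg gamma_less_1 f_nonneg[of \<theta> Item_a] assms(2) alpha_pos[of \<theta> Item_b]
    by (intro mult_mono) (auto intro: mult_left_le_one_le)
  then have "(?a - ?b + ?v) * (1 - \<gamma> * ?x) \<ge> 0" unfolding e by simp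
  then show ?thesis
    using gamma_f_less_1[of \<theta> Item_a] by (simp add: margin_weight_eq zero_le_mult_iff)
qed

end

lemma committed_profile_admissible:
  assumes "\<And>\<theta> s. \<alpha> \<theta> s > 0" "\<And>\<theta>. 1 / \<alpha> \<theta> Item_b < 1 / \<alpha> \<theta> Item_a"
    and "\<And>\<theta>. r \<theta> Item_a \<noteq> r \<theta> Item_b" "0 \<le> \<gamma>" "\<gamma> < 1"
    and adm: "\<And>\<theta>. admissible \<alpha> r \<theta> (f \<theta>)"
  shows "committed_profile \<alpha> f \<gamma>"
proof
  show "\<alpha> \<theta> s > 0" "0 \<le> \<gamma>" "\<gamma> < 1" for \<theta> s by fact+
  show range: "0 \<le> f \<theta> s" "f \<theta> s \<le> 1" for \<theta> s
    using adm[of \<theta>] by (auto simp: admissible_def)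
  show "\<exists>s. f \<theta> s = 1 \<and> f \<theta> (other s) / \<alpha> \<theta> (other s) < 1 / \<alpha> \<theta> s" for \<theta>
  proof (cases "f \<theta> Item_a = 1")
    case True
    have "f \<theta> Item_b / \<alpha> \<theta> Item_b \<le> 1 / \<alpha> \<theta> Item_b"
      using range assms(1)[of \<theta> Item_b] by (intro divide_right_mono) auto
    then show ?thesis using True assms(2)[of \<theta>] by (intro exI[of _ Item_a]) simp
  next
    case False
    have fav: "favourite r \<theta> = Item_b"
    proof (rule favourite_eq)
      have "f \<theta> (favourite r \<theta>) = 1" using adm[of \<theta>] by (simp add: admissible_def)
      then have "favourite r \<theta> \<noteq> Item_a" using False by auto
      then have "\<not> r \<theta> Item_b < r \<theta> Item_a" using favourite_eq[of r \<theta> Item_a] by auto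
      then show "r \<theta> (other Item_b) < r \<theta> Item_b" using assms(3)[of \<theta>] by simp
    qed
    then have "f \<theta> Item_b = 1" "f \<theta> Item_a < \<alpha> \<theta> Item_a / \<alpha> \<theta> Item_b"
      using adm[of \<theta>] False by (auto simp: admissible_def)
    then show ?thesis
      using assms(1)[of \<theta> Item_a] by (intro exI[of _ Item_b]) (simp add: pos_divide_less_eq)
  qed
qed

theorem corollary5p3:
  fixes \<Theta>1 \<Theta>2 :: "'t::finite set"
    and \<alpha> r :: "'t \<Rightarrow> item \<Rightarrow> real"
    and \<gamma>A \<gamma>H :: real
    and prior :: "'t belief"
    and \<sigma> :: "'t profile \<Rightarrow> 't belief \<Rightarrow> item"
    and f :: "'t profile"
    and \<theta> :: 't
  assumes "\<Theta>1 \<union> \<Theta>2 = UNIV" and "\<Theta>1 \<inter> \<Theta>2 = {}"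
    and "\<And>\<theta>' s. \<alpha> \<theta>' s > 0"
    and "\<And>\<theta>'. 1 / \<alpha> \<theta>' Item_a > 1 / \<alpha> \<theta>' Item_b"
    and "\<And>\<theta>'. \<theta>' \<in> \<Theta>1 \<Longrightarrow> r \<theta>' Item_a < r \<theta>' Item_b"
    and "\<And>\<theta>'. \<theta>' \<in> \<Theta>2 \<Longrightarrow> r \<theta>' Item_a > r \<theta>' Item_b"
    and "\<gamma>A \<in> {0..<1}" and "\<gamma>H \<in> {0..<1}"
    and "\<And>\<theta>'. prior \<theta>' \<ge> 0" and "(\<Sum>\<theta>'\<in>UNIV. prior \<theta>') = 1"
    and "best_responding \<alpha> \<gamma>A \<sigma>"
    and "AE_equilibrium \<alpha> r \<gamma>H \<sigma> prior f"
    and "\<theta> \<in> \<Theta>1"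
    and "prior \<theta> > 0"
    and "r \<theta> Item_b > 0"
    and "margin \<alpha> \<gamma>A prior f \<theta> > prior \<theta> / \<alpha> \<theta> Item_b"
    and "\<gamma>H \<noteq> r \<theta> Item_a / r \<theta> Item_b"
  shows "f \<theta> Item_b = 1 \<and>
         f \<theta> Item_a = (if \<gamma>H < r \<theta> Item_a / r \<theta> Item_b then 1 else 0)"
proof -
  have rd: "r \<theta>' Item_a \<noteq> r \<theta>' Item_b" for \<theta>'
    using assms(1) assms(5)[of \<theta>'] assms(6)[of \<theta>'] by (metis UNIV_I Un_iff less_irrefl)
  have \<gamma>A: "0 \<le> \<gamma>A" "\<gamma>A < 1" and \<gamma>H: "0 \<le> \<gamma>H" "\<gamma>H < 1"
    using assms(7,8) by auto
  have adm: "admissible \<alpha> r \<theta>' (f \<theta>')" for \<theta>'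
    using assms(12) by (simp add: AE_equilibrium_def is_arg_max_def)
  have best: "\<not> AE_payoff r \<gamma>H \<sigma> prior (f(\<theta> := f \<theta>)) \<theta> < AE_payoff r \<gamma>H \<sigma> prior (f(\<theta> := x)) \<theta>"
    if "admissible \<alpha> r \<theta> x" for x
    using assms(12) that unfolding AE_equilibrium_def is_arg_max_def by blast
  have fav: "favourite r \<theta> = Item_b"
    using assms(5)[OF assms(13)] by (intro favourite_eq) simp
  have payoff: "AE_payoff r \<gamma>H \<sigma> prior (f(\<theta> := x)) \<theta> =
      switch_payoff \<gamma>H (r \<theta> Item_a) (r \<theta> Item_b) (x Item_a)" if x: "admissible \<alpha> r \<theta> x" for x
  proof -
    define g where "g = f(\<theta> := x)"
    interpret committed_profile \<alpha> g \<gamma>A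
      using assms(3,4) rd \<gamma>A adm x
      by (intro committed_profile_admissible[where r = r]) (auto simp: g_def)
    have "margin \<alpha> \<gamma>A prior g \<theta> = margin \<alpha> \<gamma>A prior f \<theta>"
      unfolding margin_def by (intro sum.cong refl) (auto simp: margin_weight_def g_def)
    then have m: "prior \<theta> / \<alpha> \<theta> Item_b < margin \<alpha> \<gamma>A prior g \<theta>"
      using assms(16) by simp
    have "g \<theta> Item_b = 1" using x fav by (simp add: admissible_def g_def)
    then have "prior \<theta> * - (1 / \<alpha> \<theta> Item_b) \<le> prior \<theta> * margin_weight \<alpha> \<gamma>A g \<theta>"
      using assms(4,9) by (intro mult_left_mono margin_weight_ge) auto
    then have "0 < prior \<theta> * margin_weight \<alpha> \<gamma>A g \<theta> + margin \<alpha> \<gamma>A prior g \<theta>"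
      using m by simp
    also have "\<dots> = (\<Sum>\<theta>'\<in>UNIV. prior \<theta>' * margin_weight \<alpha> \<gamma>A g \<theta>')"
      by (simp add: margin_def sum.remove[of UNIV \<theta>] mult.commute)
    also have "\<dots> = commit_total Item_a prior - commit_total Item_b prior"
      by (simp add: commit_total_def margin_weight_eq sum_subtractf[symmetric] right_diff_distrib)
    finally have less: "commit_total (other Item_a) prior < commit_total Item_a prior" by simp
    have nonneg: "\<forall>\<theta>. prior \<theta> \<ge> 0" using assms(9) by blast
    have "\<sigma> g prior = Item_a" by (rule recommends[OF assms(11) nonneg less])
    then show ?thesis
      using Q_user_eq[OF assms(11) \<gamma>H nonneg assms(14) less, of r]
      by (simp add: AE_payoff_def g_def[symmetric]) (simp add: g_def)
  qed
  have fb: "f \<theta> Item_b = 1" using adm[of \<theta>] fav by (simp add: admissible_def)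
  have range: "0 \<le> f \<theta> Item_a" "f \<theta> Item_a \<le> 1" using adm[of \<theta>] by (auto simp: admissible_def)
  define c where "c y = (\<lambda>s. case s of Item_a \<Rightarrow> y | Item_b \<Rightarrow> 1)" for y :: real
  have adm_c: "admissible \<alpha> r \<theta> (c y)" if "y = 0 \<or> y = 1" for y
    using that assms(3) by (auto simp: admissible_def fav c_def split: item.split)
  have opt: "switch_payoff \<gamma>H (r \<theta> Item_a) (r \<theta> Item_b) y \<le>
      switch_payoff \<gamma>H (r \<theta> Item_a) (r \<theta> Item_b) (f \<theta> Item_a)" if "y = 0 \<or> y = 1" for y
    using best[OF adm_c[OF that]] unfolding payoff[OF adm_c[OF that]] payoff[OF adm]
    by (simp add: c_def)
  show ?thesis
  proof (cases "\<gamma>H < r \<theta> Item_a / r \<theta> Item_b")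
    case True
    then have "\<gamma>H * r \<theta> Item_b < r \<theta> Item_a" using assms(15) by (simp add: pos_less_divide_eq)
    then have "f \<theta> Item_a = 1"
      using switch_payoff_less(1)[OF \<gamma>H range] opt[of 1] range by fastforce
    then show ?thesis using fb True by simp
  next
    case False
    then have "r \<theta> Item_a < \<gamma>H * r \<theta> Item_b"
      using assms(15,17) by (simp add: less_divide_eq not_less divide_le_eq) (metis less_eq_real_def nonzero_eq_divide_eq less_irrefl)
    then have "f \<theta> Item_a = 0"
      using switch_payoff_less(2)[OF \<gamma>H range] opt[of 0] range by fastforce
    then show ?thesis using fb False by simp
  qed
qed

end
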